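(* The following two assertions are equivalent. (1) For all positive integers $m,n$ and every linear polynomial map $F=(f_1,\dots,f_m):\mathbb{Z}^n\to\mathbb{Z}^m$: if $F$ is admissible, then $F$ represents infinitely many prime points. (2) For all positive integers $m,n$ and every linear polynomial map $F=(f_1,\dots,f_m):\mathbb{Z}^n\to\mathbb{Z}^m$: if $F$ is strongly admissible, then $F$ represents infinitely many prime points.
   Context: Primes are positive primes only. For a positive integer $k$, $Z_k^*=\{x\in\mathbb{Z} : 1\le x\le k,\ \gcd(x,k)=1\}$. A polynomial map on $\mathbb{Z}^n$ is a map $F:\mathbb{Z}^n\to\mathbb{Z}^m$, $F(x)=(f_1(x),\dots,f_m(x))$, where $m,n$ are positive integers and $f_1,\dots,f_m\in\mathbb{Z}[x_1,\dots,x_n]$ are distinct polynomials. It is called linear if each $f_i$ has degree $1$ (i.e. each $f_i$ is a non-constant affine-linear form with integer coefficients). $F$ is admissible if for every positive integer $r$ there exists $x\in\mathbb{Z}^n$ such that $r$ is coprime to $\prod_{i=1}^m f_i(x)$ and moreover $f_i(x)>1$ for all $1\le i\le m$. $F$ is strongly admissible if there is a positive integer $C$ such that for every positive integer $k\ge C$ there exists $x\in\mathbb{Z}^n$ such that $f_i(x)>1$ and $f_i(x)\in Z_k^*$ for all $1\le i\le m$. $F$ represents infinitely many prime points if each $f_i$ itself takes prime values at infinitely many points of $\mathbb{Z}^n$ and, moreover, there is an infinite sequence of points $x^{(1)},x^{(2)},\dots\in\mathbb{Z}^n$ such that for every $r\ge 1$ all of $f_1(x^{(r)}),\dots,f_m(x^{(r)})$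 are primes, and for all $i\ne j$ and all $1\le l\le m$ one has $f_l(x^{(i)})\ne f_l(x^{(j)})$. *)

theory Defs
  imports
    "HOL-Library.Poly_Mapping"
    "HOL-Computational_Algebra.Primes"
    "Jordan_Normal_Form.Matrix"
begin

text \<open>
  Polynomials with integer coefficients in the indeterminates indexed by \<open>0, 1, 2, \<dots>\<close> are
  finitely supported maps from monomials to coefficients, and monomials are finitely supported
  maps from indeterminates to exponents. \<open>\<int>\<^sup>n\<close> is \<open>carrier_vec n\<close> over \<open>int\<close>, so the
  indeterminates of a polynomial on \<open>\<int>\<^sup>n\<close> are indexed by \<open>{..<n}\<close>.
\<close>

type_synonym int_mpoly = "(nat \<Rightarrow>\<^sub>0 nat) \<Rightarrow>\<^sub>0 int"

definition indets :: "int_mpoly \<Rightarrow> nat set" where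
  "indets f = (\<Union>t\<in>Poly_Mapping.keys f. Poly_Mapping.keys t)"

text \<open>By convention the zero polynomial has total degree 0.\<close>

definition total_deg :: "int_mpoly \<Rightarrow> nat" where
  "total_deg f =
     Max (insert 0 ((\<lambda>t. \<Sum>i\<in>Poly_Mapping.keys t. Poly_Mapping.lookup t i)
       ` Poly_Mapping.keys f))"

definition mpoly_eval :: "int_mpoly \<Rightarrow> int vec \<Rightarrow> int" where
  "mpoly_eval f x =
     (\<Sum>t\<in>Poly_Mapping.keys f. Poly_Mapping.lookup f t *
        (\<Prod>i\<in>Poly_Mapping.keys t. (x $ i) ^ Poly_Mapping.lookup t i))"

text \<open>
  The components \<open>f\<^sub>1, \<dots>, f\<^sub>m\<close> of a polynomial map from \<open>\<int>\<^sup>n\<close> to \<open>\<int>\<^sup>m\<close> are the values of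
  \<open>f\<close> on \<open>{..<m}\<close>; the other values of \<open>f\<close> are irrelevant.
\<close>

definition polynomial_map :: "nat \<Rightarrow> nat \<Rightarrow> (nat \<Rightarrow> int_mpoly) \<Rightarrow> bool" where
  "polynomial_map n m f \<longleftrightarrow>
     0 < n \<and> 0 < m \<and> (\<forall>i<m. indets (f i) \<subseteq> {..<n}) \<and> inj_on f {..<m}"

definition linear_polynomial_map :: "nat \<Rightarrow> nat \<Rightarrow> (nat \<Rightarrow> int_mpoly) \<Rightarrow> bool" where
  "linear_polynomial_map n m f \<longleftrightarrow> polynomial_map n m f \<and> (\<forall>i<m. total_deg (f i) = 1)"

definition Zstar :: "int \<Rightarrow> int set" where
  "Zstar k = {x. 1 \<le> x \<and> x \<le> k \<and> gcd x k = 1}"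

definition admissible :: "nat \<Rightarrow> nat \<Rightarrow> (nat \<Rightarrow> int_mpoly) \<Rightarrow> bool" where
  "admissible n m f \<longleftrightarrow>
     (\<forall>r::int. 0 < r \<longrightarrow>
        (\<exists>x\<in>carrier_vec n. coprime r (\<Prod>i<m. mpoly_eval (f i) x) \<and>
           (\<forall>i<m. 1 < mpoly_eval (f i) x)))"

definition strongly_admissible :: "nat \<Rightarrow> nat \<Rightarrow> (nat \<Rightarrow> int_mpoly) \<Rightarrow> bool" where
  "strongly_admissible n m f \<longleftrightarrow>
     (\<exists>C::int. 0 < C \<and>
        (\<forall>k\<ge>C. \<exists>x\<in>carrier_vec n.
           \<forall>i<m. 1 < mpoly_eval (f i) x \<and> mpoly_eval (f i) x \<in> Zstar k))"

text \<open>Over \<open>int\<close>, the predicate \<open>prime\<close> holds for positive primes only.\<close>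

definition represents_infinitely_many_prime_points ::
    "nat \<Rightarrow> nat \<Rightarrow> (nat \<Rightarrow> int_mpoly) \<Rightarrow> bool" where
  "represents_infinitely_many_prime_points n m f \<longleftrightarrow>
     (\<forall>i<m. infinite {x \<in> carrier_vec n. prime (mpoly_eval (f i) x)}) \<and>
     (\<exists>X :: nat \<Rightarrow> int vec.
        (\<forall>r. X r \<in> carrier_vec n \<and> (\<forall>l<m. prime (mpoly_eval (f l) (X r)))) \<and>
        (\<forall>i j. i \<noteq> j \<longrightarrow>
           (\<forall>l<m. mpoly_eval (f l) (X i) \<noteq> mpoly_eval (f l) (X j))))"

end

theory Submission
  imports Defs "HOL-Number_Theory.Cong"
begin

text \<open>
  Strong admissibility implies admissibility: use a multiple \<open>k\<close> of \<open>r\<close>. Conversely, restrict an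
  admissible linear map to a line \<open>u + t v\<close>, where it becomes \<open>t \<mapsto> a\<^sub>i t + b\<^sub>i\<close>. Points whose
  values are \<open>> 1\<close> and coprime to a large factorial have large values, which gives a direction \<open>v\<close>
  with all \<open>a\<^sub>i > 0\<close>; choosing \<open>u\<close> with \<open>b\<^sub>i\<close> coprime to \<open>m! \<Prod>a\<^sub>i\<close> removes every local
  obstruction on the line. Given \<open>k\<close>, the Chinese remainder theorem yields a suitable \<open>t\<close> below the
  radical of \<open>k\<close>. This is small enough if all prime factors of \<open>k\<close> are bounded. Otherwise \<open>k\<close> has a
  large prime factor \<open>p\<close>; omit it from the radical, \<open>Q \<le> k / p\<close>, and note that among the \<open>m + 1\<close>
  candidates \<open>t, t + Q, \<dots>, t + m Q\<close> at most \<open>m\<close> are spoiled by \<open>p\<close>.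
\<close>

section \<open>Polynomials of degree one\<close>

text \<open>In degree one every monomial is constant or a single indeterminate, so \<open>f\<close>
  is a constant plus an additive part. Subtracting the value at \<open>0\<^sub>v n\<close> removes
  the constant, and the bracket is the additive part at \<open>v\<close>, that is, the slope along
  the line.\<close>

lemma mpoly_eval_line:
  assumes deg: "total_deg f = 1" and ind: "indets f \<subseteq> {..<n}"
    and u: "u \<in> carrier_vec n" and v: "v \<in> carrier_vec n"
  shows "mpoly_eval f (u + s \<cdot>\<^sub>v v) =
    mpoly_eval f u + s * (mpoly_eval f v - mpoly_eval f (0\<^sub>v n))"
proof -
  define g :: "(nat \<Rightarrow>\<^sub>0 nat) \<Rightarrow> int vec \<Rightarrow> int"
    where "g t x = (\<Prod>i\<in>Poly_Mapping.keys t. (x $ i) ^ Poly_Mapping.lookup t i)" for t x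
  have monomial: "g t (u + s \<cdot>\<^sub>v v) = g t u + s * (g t v - g t (0\<^sub>v n))"
    if t: "t \<in> Poly_Mapping.keys f" for t
  proof (cases "Poly_Mapping.keys t = {}")
    case True
    then show ?thesis by (simp add: g_def)
  next
    case False
    then obtain i where i: "i \<in> Poly_Mapping.keys t" by blast
    have "(\<Sum>j\<in>Poly_Mapping.keys t. Poly_Mapping.lookup t j) \<le> total_deg f"
      unfolding total_deg_def using t by (intro Max_ge) auto
    then have le: "(\<Sum>j\<in>Poly_Mapping.keys t. Poly_Mapping.lookup t j) \<le> 1"
      using deg by simp
    have split: "(\<Sum>j\<in>Poly_Mapping.keys t. Poly_Mapping.lookup t j) =
        Poly_Mapping.lookup t i + (\<Sum>j\<in>Poly_Mapping.keys t - {i}. Poly_Mapping.lookup t j)"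
      using i by (simp add: sum.remove)
    have pos: "Poly_Mapping.lookup t j > 0" if "j \<in> Poly_Mapping.keys t" for j
      using that by (simp add: in_keys_iff)
    have one: "Poly_Mapping.lookup t i = 1"
      and rest: "(\<Sum>j\<in>Poly_Mapping.keys t - {i}. Poly_Mapping.lookup t j) = 0"
      using le split pos[OF i] by linarith+
    have "Poly_Mapping.keys t - {i} = {}"
      using rest pos by fastforce
    then have keys: "Poly_Mapping.keys t = {i}" using i by blast
    have "i < n" using ind t i by (auto simp: indets_def)
    then show ?thesis using u v one by (simp add: g_def keys)
  qed
  have "mpoly_eval f x = (\<Sum>t\<in>Poly_Mapping.keys f. Poly_Mapping.lookup f t * g t x)" for x
    by (simp add: mpoly_eval_def g_def)
  then show ?thesis
    by (simp add: monomial algebra_simps sum.distrib sum_subtractf sum_distrib_left)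
qed

section \<open>Values coprime to a given modulus\<close>

text \<open>Each index \<open>i\<close> rules out at most one class of \<open>j\<close> modulo
  \<open>p\<close>, and \<open>0, ..., m\<close> are distinct modulo \<open>p\<close>. If all
  \<open>m + 1\<close> candidates failed, two of them would fail at the same index.\<close>

lemma avoid_prime_pigeonhole:
  fixes c d :: "nat \<Rightarrow> int"
  assumes p: "prime p" and "int m < p" and c: "\<And>i. i < m \<Longrightarrow> \<not> p dvd c i"
  obtains j :: nat where "j \<le> m" and "\<And>i. i < m \<Longrightarrow> \<not> p dvd c i * int j + d i"
proof (rule ccontr)
  assume "\<not> thesis"
  with that have "\<forall>j\<le>m. \<exists>i<m. p dvd c i * int j + d i" by blast
  then obtain h where h: "\<And>j. j \<le> m \<Longrightarrow> h j < m \<and> p dvd c (h j) * int j + d (h j)" by metis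
  have "\<not> inj_on h {..m}"
  proof (rule pigeonhole)
    have "h ` {..m} \<subseteq> {..<m}" using h by auto
    then show "card (h ` {..m}) < card {..m}"
      using card_mono[of "{..<m}" "h ` {..m}"] by simp
  qed
  then obtain x y where xy: "x \<le> m" "y \<le> m" "x \<noteq> y" "h x = h y"
    by (auto simp: inj_on_def)
  have "p dvd (c (h x) * int x + d (h x)) - (c (h x) * int y + d (h x))"
    using h[OF xy(1)] h[OF xy(2)] xy(4) by (intro dvd_diff) auto
  then have "p dvd c (h x) * (int x - int y)" by (simp add: algebra_simps)
  then have "p dvd int x - int y"
    using p c h[OF xy(1)] by (simp add: prime_dvd_mult_iff)
  then have "\<bar>p\<bar> \<le> \<bar>int x - int y\<bar>"
    using xy(3) by (intro dvd_imp_le_int) auto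
  then show False using xy(1,2) \<open>int m < p\<close> by linarith
qed

text \<open>Good residues for the single primes are glued by the Chinese remainder theorem. Only
  residues matter, so the solution may be reduced modulo \<open>\<Prod>S\<close>; this gives the
  bound on \<open>t\<close>.\<close>

lemma avoid_primes_crt:
  fixes a b :: "nat \<Rightarrow> int" and S :: "nat set"
  assumes fin: "finite S" and S: "\<And>p. p \<in> S \<Longrightarrow> prime p"
    and loc: "\<And>p. p \<in> S \<Longrightarrow> \<exists>t::nat. \<forall>i<m. \<not> int p dvd a i * int t + b i"
  obtains t where "t < \<Prod>S" and "\<And>p i. p \<in> S \<Longrightarrow> i < m \<Longrightarrow> \<not> int p dvd a i * int t + b i"
proof -
  obtain w where w: "\<And>p i. p \<in> S \<Longrightarrow> i < m \<Longrightarrow> \<not> int p dvd a i * int (w p) + b i"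
    using loc by metis
  have "\<forall>p\<in>S. \<forall>q\<in>S. p \<noteq> q \<longrightarrow> coprime p q"
    using S by (auto intro: primes_coprime)
  then obtain x :: nat where x: "\<And>p. p \<in> S \<Longrightarrow> [x = w p] (mod p)"
    using chinese_remainder_nat[OF fin, of "\<lambda>p. p" w] by blast
  have pos: "\<Prod>S > 0" by (intro prod_pos) (simp add: S prime_gt_0_nat)
  show ?thesis
  proof
    show "x mod \<Prod>S < \<Prod>S" using pos by simp
    fix p i assume p: "p \<in> S" and i: "i < m"
    have "p dvd \<Prod>S" using fin p by (rule dvd_prodI)
    then have "[x mod \<Prod>S = w p] (mod p)"
      using x[OF p] by (simp add: cong_def mod_mod_cancel)
    then have "[int (x mod \<Prod>S) = int (w p)] (mod int p)"
      by (simp only: cong_int_iff)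
    then have "[a i * int (x mod \<Prod>S) + b i = a i * int (w p) + b i] (mod int p)"
      by (intro cong_add cong_mult cong_refl)
    then show "\<not> int p dvd a i * int (x mod \<Prod>S) + b i"
      using w[OF p i] by (simp add: cong_dvd_iff)
  qed
qed

lemma prod_prime_factors_dvd:
  fixes k :: nat
  assumes "k > 0"
  shows "\<Prod>(prime_factors k) dvd k"
proof -
  have "(\<Prod>p\<in>prime_factors k. p) dvd (\<Prod>p\<in>prime_factors k. p ^ multiplicity p k)"
    by (intro prod_dvd_prod dvd_power) (auto simp: prime_factors_multiplicity)
  then show ?thesis using assms prime_factorization_nat[of k] by simp
qed

text \<open>Coprimality alone would follow from the Chinese remainder theorem; the case distinction
  on the prime factors of \<open>k\<close> is there to keep the values at most \<open>k\<close>, as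
  membership in \<open>Zstar k\<close> demands.\<close>

lemma exists_small_coprime_values:
  fixes a b :: "nat \<Rightarrow> int"
  assumes a: "\<And>i. i < m \<Longrightarrow> 0 < a i" and b: "\<And>i. i < m \<Longrightarrow> 0 < b i"
    and loc: "\<And>p::nat. prime p \<Longrightarrow> \<exists>t::nat. \<forall>i<m. \<not> int p dvd a i * int t + b i"
  obtains C :: int where "0 < C"
    and "\<And>k. C \<le> k \<Longrightarrow> \<exists>t::nat. \<forall>i<m. a i * int t + b i \<le> k \<and> coprime (a i * int t + b i) k"
proof -
  define A B where "A = (\<Sum>i<m. a i)" and "B = (\<Sum>i<m. b i)"
  have A: "a i \<le> A" if "i < m" for i
    unfolding A_def using that a by (intro member_le_sum) (auto intro: less_imp_le)
  have B: "b i \<le> B" if "i < m" for i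
    unfolding B_def using that b by (intro member_le_sum) (auto intro: less_imp_le)
  have A0: "0 \<le> A" and B0: "0 \<le> B"
    unfolding A_def B_def using a b by (auto intro!: sum_nonneg intro: less_imp_le)
  \<comment> \<open>A prime above \<open>K\<close> exceeds every \<open>a i\<close>, exceeds
    \<open>m\<close>, and exceeds \<open>A * (m + 1) + B\<close>. The large-prime case uses all
    three.\<close>
  define K where "K = A * (int m + 1) + B + int m"
  have K: "0 \<le> K" "A \<le> K" "int m \<le> K" using A0 B0 by (simp_all add: K_def algebra_simps)
  define N where "N = nat K"
  \<comment> \<open>If all prime factors of \<open>k\<close> are at most \<open>K\<close>, then
    \<open>t \<le> fact N\<close> and the values stay below \<open>C\<close>. The final
    \<open>1\<close> makes \<open>C\<close> positive even when both sums vanish.\<close>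
  define C where "C = A * fact N + B + 1"
  have coprime_if: "coprime z (int k)"
    if "\<And>p. p \<in> prime_factors k \<Longrightarrow> \<not> int p dvd z" "k > 0" for z k
  proof (rule ccontr)
    assume nc: "\<not> coprime z (int k)"
    then obtain q where q: "prime q" "q dvd gcd z (int k)"
      using prime_divisor_exists[of "gcd z (int k)"] \<open>k > 0\<close>
      by (auto simp: coprime_iff_gcd_eq_1)
    define p where "p = nat q"
    have qp: "q = int p" using q(1) by (simp add: p_def prime_ge_0_int)
    have "prime p" "p dvd k" "int p dvd z" using q unfolding qp by auto
    then show False using that by (auto simp: in_prime_factors_iff)
  qed
  show ?thesis
  proof
    show "0 < C" using A0 B0 by (simp add: C_def add_nonneg_pos)
    fix k' assume Ck: "C \<le> k'"
    define k where "k = nat k'"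
    have k': "k' = int k" and k0: "k > 0" using Ck \<open>0 < C\<close> by (auto simp: k_def)
    define S where "S = prime_factors k"
    have finS: "finite S" and primeS: "\<And>p. p \<in> S \<Longrightarrow> prime p" by (auto simp: S_def)
    show "\<exists>t::nat. \<forall>i<m. a i * int t + b i \<le> k' \<and> coprime (a i * int t + b i) k'"
    proof (cases "\<exists>p\<in>S. K < int p")
      case False
      obtain t where t: "t < \<Prod>S" "\<And>p i. p \<in> S \<Longrightarrow> i < m \<Longrightarrow> \<not> int p dvd a i * int t + b i"
        using avoid_primes_crt[OF finS primeS, of m a b] loc[OF primeS] by blast
      have "S \<subseteq> {1..N}"
      proof
        fix p assume p: "p \<in> S"
        then have "int p \<le> K" using False by (auto simp: not_less)
        then show "p \<in> {1..N}" using prime_ge_1_nat[OF primeS[OF p]] by (simp add: N_def)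
      qed
      \<comment> \<open>The elements of \<open>S\<close> are distinct factors of
        \<open>1 * ... * N\<close>.\<close>
      then have "\<Prod>S dvd fact N"
        unfolding fact_prod of_nat_id by (intro prod_dvd_prod_subset) auto
      then have "\<Prod>S \<le> fact N" by (intro dvd_imp_le) auto
      then have "int t \<le> int (fact N)" using t(1) by (simp only: of_nat_le_iff)
      then have tN: "int t \<le> fact N" by simp
      have "a i * int t + b i \<le> k'" if "i < m" for i
      proof -
        have "a i * int t \<le> A * fact N"
          using A[OF that] A0 tN by (intro mult_mono) auto
        then show ?thesis using B[OF that] Ck unfolding C_def by linarith
      qed
      moreover have "coprime (a i * int t + b i) k'" if "i < m" for i
        unfolding k' using t(2) that k0 by (intro coprime_if) (auto simp: S_def)
      ultimately show ?thesis by blast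
    next
      case True
      then obtain p where p: "p \<in> S" "K < int p" by blast
      define Q where "Q = \<Prod>(S - {p})"
      obtain t where t: "t < Q"
          "\<And>q i. q \<in> S - {p} \<Longrightarrow> i < m \<Longrightarrow> \<not> int q dvd a i * int t + b i"
        using avoid_primes_crt[of "S - {p}" m a b] finS loc[OF primeS] primeS unfolding Q_def
        by blast
      have pp: "prime (int p)" using primeS p(1) by simp
      have "\<not> p dvd Q"
      proof
        assume "p dvd Q"
        then obtain q where q: "q \<in> S" "q \<noteq> p" "p dvd q"
          using prime_dvd_prod_iff[of "S - {p}" p "\<lambda>q. q"] finS primeS[OF p(1)]
          by (auto simp: Q_def)
        then show False using primes_dvd_imp_eq[OF primeS[OF p(1)] primeS[OF q(1)]] by simp
      qed
      \<comment> \<open>Since \<open>0 < a i \<le> K < p\<close>, the prime divides neither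
        \<open>a i\<close> nor \<open>Q\<close>, so the step \<open>a i * Q\<close> is invertible
        modulo \<open>p\<close>.\<close>
      then have nd: "\<not> int p dvd a i * int Q" if "i < m" for i
        using pp a[OF that] A[OF that] K p(2)
        by (auto simp: prime_dvd_mult_iff dest!: zdvd_imp_le)
      have mp: "int m < int p" using K p(2) by linarith
      obtain j where j: "j \<le> m"
          "\<And>i. i < m \<Longrightarrow> \<not> int p dvd (a i * int Q) * int j + (a i * int t + b i)"
        using avoid_prime_pigeonhole[OF pp mp, of "\<lambda>i. a i * int Q" "\<lambda>i. a i * int t + b i"] nd
        by blast
      \<comment> \<open>A shift by a multiple of \<open>Q\<close> keeps all residues modulo the
        primes in \<open>S - {p}\<close>, while \<open>j\<close> is chosen to avoid
        \<open>p\<close>.\<close>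
      define s where "s = t + Q * j"
      have s: "a i * int s + b i = (a i * int Q) * int j + (a i * int t + b i)" for i
        by (simp add: s_def algebra_simps)
      have pQ: "p * Q dvd k"
        using prod_prime_factors_dvd[OF k0] p(1) finS
        by (simp add: Q_def S_def prod.remove)
      then have "p * Q \<le> k" using k0 by (rule dvd_imp_le)
      then have pQk: "int p * int Q \<le> k'" unfolding k' by (simp flip: of_nat_mult)
      have "t + Q * j \<le> Q + Q * m" using t(1) j(1) by (intro add_mono mult_mono) auto
      then have "int s \<le> int (Q + Q * m)" unfolding s_def by (simp only: of_nat_le_iff)
      then have sQ: "int s \<le> int Q * (int m + 1)" by (simp add: algebra_simps)
      \<comment> \<open>This absorbs \<open>b i\<close> into a multiple of \<open>Q\<close>, so
        every value is at most \<open>(A * (m + 1) + B) * Q \<le> p * Q \<le> k\<close>.\<close>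
      have "1 \<le> int Q" using t(1) by simp
      have "a i * int s + b i \<le> k'" if "i < m" for i
      proof -
        have "a i * int s \<le> A * (int Q * (int m + 1))"
          using A[OF that] A0 sQ by (intro mult_mono) auto
        moreover have "b i \<le> B * int Q"
          using B[OF that] mult_left_mono[OF \<open>1 \<le> int Q\<close> B0] by linarith
        ultimately have "a i * int s + b i \<le> (A * (int m + 1) + B) * int Q"
          by (simp add: algebra_simps)
        also have "\<dots> \<le> int p * int Q"
          using p(2) by (intro mult_right_mono) (auto simp: K_def)
        finally show ?thesis using pQk by linarith
      qed
      moreover have "coprime (a i * int s + b i) k'" if i: "i < m" for i
        unfolding k'
      proof (rule coprime_if[OF _ k0])
        fix q assume q: "q \<in> prime_factors k"
        show "\<not> int q dvd a i * int s + b i"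
        proof (cases "q = p")
          case True
          then show ?thesis unfolding s using j(2)[OF i] by simp
        next
          case False
          then have qS: "q \<in> S - {p}" using q by (simp add: S_def)
          then have "q dvd Q" unfolding Q_def using finS by (intro dvd_prodI) auto
          then have "int q dvd (a i * int Q) * int j" by simp
          then show ?thesis unfolding s using t(2)[OF qS i] by (simp add: dvd_add_right_iff)
        qed
      qed
      ultimately show ?thesis by blast
    qed
  qed
qed

section \<open>Admissibility and strong admissibility\<close>

lemma strongly_admissible_imp_admissible:
  assumes "strongly_admissible n m f"
  shows "admissible n m f"
  unfolding admissible_def
proof (intro allI impI)
  fix r :: int assume r: "0 < r"
  obtain C where C: "0 < C"
    and *: "\<forall>k\<ge>C. \<exists>x\<in>carrier_vec n. \<forall>i<m. 1 < mpoly_eval (f i) x \<and> mpoly_eval (f i) x \<in> Zstar k"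
    using assms by (auto simp: strongly_admissible_def)
  \<comment> \<open>The modulus \<open>C * r\<close> is both a multiple of \<open>r\<close> and at
    least \<open>C\<close>.\<close>
  have "C * 1 \<le> C * r" using C r by (intro mult_left_mono) auto
  then obtain x where x: "x \<in> carrier_vec n"
      "\<forall>i<m. 1 < mpoly_eval (f i) x \<and> mpoly_eval (f i) x \<in> Zstar (C * r)"
    using * by auto
  have "coprime r (mpoly_eval (f i) x)" if "i < m" for i
  proof -
    have "coprime (mpoly_eval (f i) x) (C * r)"
      using x(2) that by (simp add: Zstar_def coprime_iff_gcd_eq_1)
    then show ?thesis by (simp add: coprime_commute)
  qed
  then show "\<exists>x\<in>carrier_vec n. coprime r (\<Prod>i<m. mpoly_eval (f i) x) \<and>
      (\<forall>i<m. 1 < mpoly_eval (f i) x)"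
    using x by (auto intro!: bexI[of _ x] prod_coprime_right)
qed

lemma admissible_imp_strongly_admissible:
  assumes lin: "linear_polynomial_map n m f" and adm: "admissible n m f"
  shows "strongly_admissible n m f"
proof -
  define e where "e i x = mpoly_eval (f i) x" for i x
  have line: "e i (x + s \<cdot>\<^sub>v y) = e i x + s * (e i y - e i (0\<^sub>v n))"
    if "i < m" "x \<in> carrier_vec n" "y \<in> carrier_vec n" for i x y s
    using lin that unfolding e_def linear_polynomial_map_def polynomial_map_def
    by (intro mpoly_eval_line) auto
  have adm': "\<exists>x\<in>carrier_vec n. \<forall>i<m. coprime r (e i x) \<and> 1 < e i x" if r: "0 < r" for r
  proof -
    obtain x where x: "x \<in> carrier_vec n" "coprime r (\<Prod>i<m. e i x)" "\<forall>i<m. 1 < e i x"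
      using adm r unfolding admissible_def e_def by blast
    have "coprime r (e i x)" if "i < m" for i
      using that by (intro coprime_divisors[OF dvd_refl _ x(2)] dvd_prodI) auto
    then show ?thesis using x by blast
  qed
  define N where "N = nat (\<Sum>i<m. \<bar>e i (0\<^sub>v n)\<bar>)"
  obtain v where v: "v \<in> carrier_vec n" "\<And>i. i < m \<Longrightarrow> coprime (fact N) (e i v) \<and> 1 < e i v"
    using adm'[of "fact N"] by auto
  define a where "a i = e i v - e i (0\<^sub>v n)" for i
  have a: "0 < a i" if i: "i < m" for i
  proof -
    \<comment> \<open>A value in \<open>{2..N}\<close> would divide \<open>fact N\<close>, to which
      it is coprime. As \<open>N\<close> bounds the absolute values at the origin, the slope is
      positive.\<close>
    have "int N < e i v"
    proof (rule ccontr)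
      assume "\<not> int N < e i v"
      then have "nat (e i v) dvd fact N" using v(2)[OF i] by (intro dvd_fact) auto
      then have "int (nat (e i v)) dvd int (fact N)" by (simp only: of_nat_dvd_iff)
      then have "e i v dvd fact N" using v(2)[OF i] by simp
      then have "is_unit (e i v)" using v(2)[OF i] by (meson coprime_common_divisor dvd_refl)
      then show False using v(2)[OF i] by simp
    qed
    moreover have "\<bar>e i (0\<^sub>v n)\<bar> \<le> int N"
      using i member_le_sum[of i "{..<m}" "\<lambda>i. \<bar>e i (0\<^sub>v n)\<bar>"] by (simp add: N_def sum_nonneg)
    ultimately show ?thesis by (simp add: a_def)
  qed
  \<comment> \<open>This modulus collects the primes for which the pigeonhole argument may fail:
    those up to \<open>m\<close> and those dividing a slope. For them \<open>t = 0\<close> works, by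
    the choice of \<open>u\<close>.\<close>
  have "0 < fact m * (\<Prod>i<m. a i)" using a by (auto intro!: mult_pos_pos prod_pos)
  then obtain u where u: "u \<in> carrier_vec n"
      "\<And>i. i < m \<Longrightarrow> coprime (fact m * (\<Prod>i<m. a i)) (e i u) \<and> 1 < e i u"
    using adm' by blast
  have loc: "\<exists>t::nat. \<forall>i<m. \<not> int p dvd a i * int t + e i u" if p: "prime p" for p :: nat
  proof (cases "int p dvd fact m * (\<Prod>i<m. a i)")
    case True
    then have "\<not> int p dvd e i u" if "i < m" for i
      using u(2)[OF that] p by (metis coprime_common_divisor not_prime_unit prime_nat_int_transfer)
    then show ?thesis by (intro exI[of _ 0]) simp
  next
    case False
    have "\<not> p dvd fact m"
    proof
      assume "p dvd fact m"
      then have "int p dvd int (fact m)" by (simp only: of_nat_dvd_iff)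
      then show False using False by simp
    qed
    then have mp: "int m < int p" using p by (simp add: prime_dvd_fact_iff)
    have "\<not> int p dvd a i" if "i < m" for i
      using False that dvd_trans[OF _ dvd_prodI[of "{..<m}" i a]] by auto
    then show ?thesis
      using avoid_prime_pigeonhole[of "int p" m a "\<lambda>i. e i u"] mp p
      by (metis prime_nat_int_transfer)
  qed
  have u0: "0 < e i u" if "i < m" for i using u(2)[OF that] by simp
  obtain C where C: "0 < C" "\<And>k. C \<le> k \<Longrightarrow>
      \<exists>t::nat. \<forall>i<m. a i * int t + e i u \<le> k \<and> coprime (a i * int t + e i u) k"
    using exists_small_coprime_values[of m a "\<lambda>i. e i u"] a u0 loc by blast
  have "\<exists>x\<in>carrier_vec n. \<forall>i<m. 1 < e i x \<and> e i x \<in> Zstar k" if k: "C \<le> k" for k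
  proof -
    obtain t :: nat where
      t: "\<And>i. i < m \<Longrightarrow> a i * int t + e i u \<le> k \<and> coprime (a i * int t + e i u) k"
      using C(2)[OF k] by blast
    \<comment> \<open>Positive slopes and \<open>t \<ge> 0\<close> keep the values on the line at
      least as large as at \<open>u\<close>, hence above 1.\<close>
    define x where "x = u + int t \<cdot>\<^sub>v v"
    have "1 < e i x \<and> e i x \<in> Zstar k" if i: "i < m" for i
    proof -
      have ex: "e i x = a i * int t + e i u"
        using line[OF i u(1) v(1)] by (simp add: x_def a_def)
      have "0 \<le> a i * int t" using a[OF i] by simp
      then have "1 < e i x" using u(2)[OF i] unfolding ex by linarith
      then show ?thesis using t[OF i] by (simp add: Zstar_def ex coprime_iff_gcd_eq_1)
    qed
    moreover have "x \<in> carrier_vec n" using u(1) v(1) by (simp add: x_def)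
    ultimately show ?thesis by blast
  qed
  then show ?thesis using C(1) unfolding strongly_admissible_def e_def by blast
qed

theorem theorem1:
  shows "(\<forall>m>0. \<forall>n>0. \<forall>f. linear_polynomial_map n m f \<longrightarrow>
            admissible n m f \<longrightarrow> represents_infinitely_many_prime_points n m f)
         \<longleftrightarrow>
         (\<forall>m>0. \<forall>n>0. \<forall>f. linear_polynomial_map n m f \<longrightarrow>
            strongly_admissible n m f \<longrightarrow> represents_infinitely_many_prime_points n m f)"
  using strongly_admissible_imp_admissible admissible_imp_strongly_admissible by blast

end
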